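(* For every $n\in\{1,2,\ldots\}$ and every $z=x+iy\in\mathbb C$ ($x,y\in\mathbb R$), the normalized Hermite function $\zeta_n$ satisfies $$|\zeta_n(z)|\le \sqrt[4]{\frac{2e^3}{\pi^2}}\; e^{\frac{|z|^2}{2}+x^2+|y|}\,e^{2n|y|}.$$
   Context: The (physicists') Hermite polynomials are $H_n(z)=(-1)^n e^{z^2}\left(\frac{d}{dz}\right)^n e^{-z^2}$, $n=0,1,2,\ldots$. The normalized Hermite functions are the entire functions $$\zeta_n(z)=\frac{1}{\pi^{1/4}2^{n/2}(n!)^{1/2}}(-1)^n e^{-\frac{z^2}{2}}H_n(z),\quad n=0,1,\ldots$$ *)

theory Defs
  imports "HOL-Analysis.Analysis"
begin

(* Physicists' Hermite polynomials, via the Rodrigues formula; deriv is the complex derivative. *)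
definition hermite :: "nat \<Rightarrow> complex \<Rightarrow> complex" where
  "hermite n z = (-1) ^ n * exp (z\<^sup>2) * (deriv ^^ n) (\<lambda>w. exp (- (w\<^sup>2))) z"

(* The factor (-1)^n here is in addition to the one in the definition of hermite. *)
definition hermite_fun :: "nat \<Rightarrow> complex \<Rightarrow> complex" where
  "hermite_fun n z =
     of_real (1 / (pi powr (1/4) * 2 powr (real n / 2) * fact n powr (1/2)))
       * (-1) ^ n * exp (- (z\<^sup>2 / 2)) * hermite n z"

end

theory Submission
  imports Defs
begin

text \<open>
  Put \<open>n = m + 1\<close> and consider \<open>G = \<bar>H\<^sub>n\<bar>\<^sup>2 + 2 n \<bar>H\<^sub>m\<bar>\<^sup>2\<close> along the segment \<open>t \<mapsto> t z\<close>, \<open>0 \<le> t \<le> 1\<close>.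
  From \<open>H\<^sub>n' = 2 n H\<^sub>m\<close> and \<open>H\<^sub>m' = 2 z H\<^sub>m - H\<^sub>n\<close> one gets the differential inequality
  \<open>G' \<le> (4 n \<bar>y\<bar> + 4 t x\<^sup>2) G\<close>: the cross terms cancel except for their part in \<open>y\<close>.
  Since \<open>G 0 \<le> 2^n n!\<close>, Gronwall's inequality yields
  \<open>\<bar>H\<^sub>n z\<bar>\<^sup>2 \<le> 2^n n! exp (4 n \<bar>y\<bar> + 2 x\<^sup>2)\<close>, which is stronger than needed.
\<close>

text \<open>The classical three-term recurrence, which lets derivative identities be proved by
  induction; \<open>hermite_eq_rec\<close> ties it to the Rodrigues formula.\<close>

fun hermite_rec :: "nat \<Rightarrow> complex \<Rightarrow> complex" where
  "hermite_rec 0 z = 1"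
| "hermite_rec (Suc 0) z = 2 * z"
| "hermite_rec (Suc (Suc n)) z = 2 * z * hermite_rec (Suc n) z - 2 * of_nat (Suc n) * hermite_rec n z"

text \<open>Differentiate the recurrence: the two induction hypotheses recombine, by the recurrence
  one index lower, into a multiple of a single polynomial.\<close>

lemma has_field_derivative_hermite_rec_Suc:
  "(hermite_rec (Suc n) has_field_derivative 2 * of_nat (Suc n) * hermite_rec n z) (at z)"
proof (induction n rule: induct_nat_012)
  case 0
  show ?case by (auto intro!: derivative_eq_intros)
next
  case 1
  show ?case by (auto intro!: derivative_eq_intros)
next
  case (ge2 n)
  show ?case
    unfolding hermite_rec.simps(3)[of "Suc n", abs_def]
    by (rule derivative_eq_intros refl ge2)+ (simp add: algebra_simps)
qed

text \<open>Inserting the recurrence into the previous formula gives a form without a predecessor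
  index, valid also for \<open>n = 0\<close>.\<close>

lemma has_field_derivative_hermite_rec:
  "(hermite_rec n has_field_derivative 2 * z * hermite_rec n z - hermite_rec (Suc n) z) (at z)"
proof (cases n)
  case 0
  have "hermite_rec 0 = (\<lambda>z. 1)"
    by (rule ext) simp
  then show ?thesis by (simp add: 0)
next
  case (Suc m)
  show ?thesis
    using has_field_derivative_hermite_rec_Suc[of m z] by (simp add: Suc)
qed

text \<open>Differentiating the Gaussian contributes \<open>- 2 * z\<close>, which turns the
  derivative of \<open>hermite_rec n\<close> into \<open>- hermite_rec (Suc n)\<close>.\<close>

lemma deriv_gaussian:
  "(deriv ^^ n) (\<lambda>w. exp (- (w\<^sup>2))) = (\<lambda>z. (-1) ^ n * hermite_rec n z * exp (- (z\<^sup>2)))"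
proof (induction n)
  case 0
  show ?case by simp
next
  case (Suc n)
  have "((\<lambda>z. (-1) ^ n * hermite_rec n z * exp (- (z\<^sup>2))) has_field_derivative
          (-1) ^ Suc n * hermite_rec (Suc n) z * exp (- (z\<^sup>2))) (at z)" for z
    by (rule derivative_eq_intros refl has_field_derivative_hermite_rec)+
      (simp add: algebra_simps)
  then show ?case
    by (simp only: funpow.simps o_def Suc.IH) (auto intro: DERIV_imp_deriv)
qed

lemma hermite_eq_rec: "hermite n z = hermite_rec n z"
proof -
  have "hermite n z = ((-1) ^ n * (-1) ^ n) * (exp (z\<^sup>2) * exp (- (z\<^sup>2))) * hermite_rec n z"
    unfolding hermite_def deriv_gaussian by (simp only: mult_ac)
  also have "\<dots> = hermite_rec n z"
    by (simp flip: power_mult_distrib exp_add)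
  finally show ?thesis .
qed

text \<open>The weight \<open>2 * real (Suc n)\<close> equals the factor in the derivative of
  \<open>hermite_rec (Suc n)\<close>; this makes the cross terms of the energy's derivative cancel
  on the real axis.\<close>

definition hermite_energy :: "nat \<Rightarrow> complex \<Rightarrow> real" where
  "hermite_energy n z =
     (cmod (hermite_rec (Suc n) z))\<^sup>2 + 2 * real (Suc n) * (cmod (hermite_rec n z))\<^sup>2"

text \<open>At 0 the recurrence loses its middle term. Enlarging one factor n+1 to n+2 then bounds
  each energy by 2(n+2) times the preceding one.\<close>

lemma hermite_energy_0: "hermite_energy n 0 \<le> 2 ^ Suc n * fact (Suc n)"
proof (induction n)
  case 0
  show ?case by (simp add: hermite_energy_def)
next
  case (Suc n)
  define a b where "a = (cmod (hermite_rec (Suc n) 0))\<^sup>2" and "b = (cmod (hermite_rec n 0))\<^sup>2"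
  have "hermite_energy (Suc n) 0 = 2 * real (Suc (Suc n)) * a + 4 * (real (Suc n))\<^sup>2 * b"
    by (simp add: hermite_energy_def a_def b_def norm_mult power_mult_distrib del: of_nat_Suc)
  also have "\<dots> \<le> 2 * real (Suc (Suc n)) * a + 4 * (real (Suc n) * real (Suc (Suc n))) * b"
    unfolding power2_eq_square b_def by (intro add_left_mono mult_right_mono mult_left_mono) auto
  also have "\<dots> = 2 * real (Suc (Suc n)) * hermite_energy n 0"
    by (simp add: hermite_energy_def a_def b_def algebra_simps)
  also have "\<dots> \<le> 2 * real (Suc (Suc n)) * (2 ^ Suc n * fact (Suc n))"
    by (intro mult_left_mono Suc.IH) auto
  also have "\<dots> = 2 ^ Suc (Suc n) * fact (Suc (Suc n))"
    by (simp add: algebra_simps)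
  finally show ?case .
qed

lemma has_real_derivative_cmod_squared:
  assumes "(f has_field_derivative D) (at (of_real t * w))"
  shows "((\<lambda>t. (cmod (f (of_real t * w)))\<^sup>2) has_real_derivative
           2 * Re (cnj (f (of_real t * w)) * (w * D))) (at t)"
proof -
  have "((\<lambda>t. of_real t * w) has_vector_derivative w) (at t)"
    by (auto intro!: derivative_eq_intros)
  then have "((\<lambda>t. f (of_real t * w)) has_vector_derivative w * D) (at t)"
    using field_vector_diff_chain_at[of "\<lambda>t. of_real t * w" w t f D] assms by (simp add: o_def)
  then have "((\<lambda>t. Re (f (of_real t * w))) has_real_derivative Re (w * D)) (at t)"
    and "((\<lambda>t. Im (f (of_real t * w))) has_real_derivative Im (w * D)) (at t)"
    by (auto simp: has_vector_derivative_complex_iff)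
  note D = this
  show ?thesis
    unfolding cmod_power2
    by (rule derivative_eq_intros refl D)+ (simp add: algebra_simps)
qed

text \<open>Here \<open>a\<close>, \<open>b\<close> stand for the polynomials of index n+1 and n at
  \<open>t * w\<close>, and \<open>N\<close> for n+1; the left side is the derivative of the energy
  along the ray.\<close>

lemma hermite_energy_growth:
  fixes a b w :: complex and t N :: real
  assumes "N \<ge> 1" and "t \<ge> 0"
  shows "2 * Re (cnj a * (w * (2 * of_real N * b)))
           + 2 * N * (2 * Re (cnj b * (w * (2 * (of_real t * w) * b - a))))
         \<le> (4 * N * \<bar>Im w\<bar> + 4 * t * (Re w)\<^sup>2) * ((cmod a)\<^sup>2 + 2 * N * (cmod b)\<^sup>2)"
    (is "?L \<le> (?p + ?q) * ?G")
proof -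
  define s where "s = Re a * Im b - Im a * Re b"
  \<comment> \<open>The cross terms add up to 4N Re(w (c - cnj c)) with c =
    \<open>cnj a * b\<close>. As c - cnj c = 2i Im c and \<open>s\<close> is Im c, only Im w
    survives.\<close>
  have L: "?L = - (8 * N * Im w * s) + 4 * t * ((Re w)\<^sup>2 - (Im w)\<^sup>2) * (2 * N * (cmod b)\<^sup>2)"
    unfolding s_def cmod_power2 by (simp add: algebra_simps power2_eq_square)
  have "\<bar>s\<bar> = \<bar>Im (cnj a * b)\<bar>"
    by (simp add: s_def)
  also have "\<dots> \<le> cmod a * cmod b"
    using abs_Im_le_cmod[of "cnj a * b"] by (simp add: norm_mult)
  finally have "2 * \<bar>s\<bar> \<le> (cmod a)\<^sup>2 + (cmod b)\<^sup>2"
    using sum_squares_bound[of "cmod a" "cmod b"] by linarith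
  also have "\<dots> \<le> ?G"
    using mult_right_mono[of 1 "2 * N" "(cmod b)\<^sup>2"] assms by simp
  finally have s: "2 * \<bar>s\<bar> \<le> ?G" .
  have "- (8 * N * Im w * s) \<le> \<bar>8 * N * Im w * s\<bar>"
    by linarith
  also have "\<dots> = ?p * (2 * \<bar>s\<bar>)"
    using assms by (simp add: abs_mult)
  also have "\<dots> \<le> ?p * ?G"
    using assms by (intro mult_left_mono s) auto
  finally have p: "- (8 * N * Im w * s) \<le> ?p * ?G" .
  \<comment> \<open>Drop the negative square of Im w and add the nonnegative \<open>a\<close> term
    of the energy.\<close>
  have q: "4 * t * ((Re w)\<^sup>2 - (Im w)\<^sup>2) * (2 * N * (cmod b)\<^sup>2) \<le> ?q * ?G"
    using assms by (intro mult_mono mult_left_mono) auto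
  show ?thesis
    unfolding L distrib_right using p q by linarith
qed

lemma hermite_energy_bound:
  "hermite_energy n z
     \<le> 2 ^ Suc n * fact (Suc n) * exp (4 * real (Suc n) * \<bar>Im z\<bar> + 2 * (Re z)\<^sup>2)"
proof -
  define N where "N = real (Suc n)"
  \<comment> \<open>\<open>P\<close> is the antiderivative of the growth rate with
    \<open>P 0 = 0\<close>, so \<open>exp (- P t)\<close> is the integrating factor that makes
    \<open>g\<close> nonincreasing.\<close>
  define P where "P t = 4 * N * \<bar>Im z\<bar> * t + 2 * (Re z)\<^sup>2 * t\<^sup>2" for t :: real
  define g where "g t = hermite_energy n (of_real t * z) * exp (- P t)" for t :: real
  have N: "N \<ge> 1" "of_nat (Suc n) = complex_of_real N"
    by (simp_all add: N_def)
  have "g 1 \<le> g 0"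
  proof (rule DERIV_nonpos_imp_nonincreasing, simp, intro exI conjI)
    fix t :: real
    assume t: "0 \<le> t" "t \<le> 1"
    define v where "v = of_real t * z"
    define a b where "a = hermite_rec (Suc n) v" and "b = hermite_rec n v"
    let ?D = "2 * Re (cnj a * (z * (2 * of_real N * b)))
           + 2 * N * (2 * Re (cnj b * (z * (2 * (of_real t * z) * b - a))))"
    have E: "((\<lambda>t. hermite_energy n (of_real t * z)) has_real_derivative ?D) (at t)"
      unfolding hermite_energy_def a_def b_def v_def N(2)[symmetric] unfolding N_def
      by (intro DERIV_add DERIV_cmult has_real_derivative_cmod_squared
          has_field_derivative_hermite_rec has_field_derivative_hermite_rec_Suc)
    have P: "((\<lambda>t. exp (- P t)) has_real_derivative
               - (4 * N * \<bar>Im z\<bar> + 4 * t * (Re z)\<^sup>2) * exp (- P t)) (at t)"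
      unfolding P_def by (rule derivative_eq_intros refl)+ simp
    show "DERIV g t :> (?D - (4 * N * \<bar>Im z\<bar> + 4 * t * (Re z)\<^sup>2) * hermite_energy n v) * exp (- P t)"
      unfolding g_def[abs_def] v_def
      by (rule derivative_eq_intros refl E P)+ (simp add: algebra_simps)
    have "?D \<le> (4 * N * \<bar>Im z\<bar> + 4 * t * (Re z)\<^sup>2) * hermite_energy n v"
      using hermite_energy_growth[OF N(1) t(1), of a z b]
      by (simp add: hermite_energy_def a_def b_def N_def)
    then show "(?D - (4 * N * \<bar>Im z\<bar> + 4 * t * (Re z)\<^sup>2) * hermite_energy n v) * exp (- P t) \<le> 0"
      by (simp add: mult_le_0_iff)
  qed
  then have "hermite_energy n z * exp (- P 1) \<le> 2 ^ Suc n * fact (Suc n)"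
    using hermite_energy_0[of n] by (simp add: g_def P_def)
  then have "hermite_energy n z \<le> 2 ^ Suc n * fact (Suc n) * exp (P 1)"
    unfolding exp_minus divide_inverse[symmetric] by (simp only: pos_divide_le_eq exp_gt_zero)
  then show ?thesis
    by (simp add: P_def N_def)
qed

lemma cmod_hermite_le:
  assumes "n \<ge> 1"
  shows "cmod (hermite n z) \<le> sqrt (2 ^ n * fact n) * exp (2 * real n * \<bar>Im z\<bar> + (Re z)\<^sup>2)"
proof (rule power2_le_imp_le)
  obtain m where m: "n = Suc m"
    using assms by (cases n) auto
  have "(cmod (hermite n z))\<^sup>2 \<le> hermite_energy m z"
    by (simp add: hermite_energy_def hermite_eq_rec m)
  also have "\<dots> \<le> 2 ^ n * fact n * exp (4 * real n * \<bar>Im z\<bar> + 2 * (Re z)\<^sup>2)"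
    unfolding m by (rule hermite_energy_bound)
  also have "\<dots> = (sqrt (2 ^ n * fact n) * exp (2 * real n * \<bar>Im z\<bar> + (Re z)\<^sup>2))\<^sup>2"
    by (simp add: power_mult_distrib flip: exp_double)
  finally show "(cmod (hermite n z))\<^sup>2
      \<le> (sqrt (2 ^ n * fact n) * exp (2 * real n * \<bar>Im z\<bar> + (Re z)\<^sup>2))\<^sup>2" .
qed simp

text \<open>The normalization cancels the square root of 2^n n!, and - Re(z^2)/2 + (Re z)^2 =
  |z|^2/2.\<close>

lemma cmod_hermite_fun_le:
  assumes "n \<ge> 1"
  shows "cmod (hermite_fun n z) \<le> pi powr (- 1/4) * exp ((cmod z)\<^sup>2 / 2 + 2 * real n * \<bar>Im z\<bar>)"
proof -
  define S where "S = sqrt (2 ^ n * fact n)"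
  have S: "S > 0"
    by (simp add: S_def)
  have "2 powr (real n / 2) = sqrt (2 powr real n)"
    by (simp add: powr_half_sqrt[symmetric] powr_powr)
  then have S_eq: "2 powr (real n / 2) * fact n powr (1/2) = S"
    by (simp add: S_def powr_half_sqrt powr_realpow real_sqrt_mult)
  have "cmod (hermite_fun n z) = 1 / (pi powr (1/4) * S) * exp (- Re (z\<^sup>2) / 2) * cmod (hermite n z)"
    unfolding hermite_fun_def mult.assoc S_eq using S
    by (simp add: norm_mult norm_power norm_divide)
  also have "\<dots> \<le> 1 / (pi powr (1/4) * S) * exp (- Re (z\<^sup>2) / 2)
                   * (S * exp (2 * real n * \<bar>Im z\<bar> + (Re z)\<^sup>2))"
    unfolding S_def by (intro mult_left_mono cmod_hermite_le assms) simp
  also have "\<dots> = pi powr (- 1/4) * (exp (- Re (z\<^sup>2) / 2) * exp (2 * real n * \<bar>Im z\<bar> + (Re z)\<^sup>2))"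
    using S by (simp add: powr_minus field_simps)
  also have "exp (- Re (z\<^sup>2) / 2) * exp (2 * real n * \<bar>Im z\<bar> + (Re z)\<^sup>2)
      = exp ((cmod z)\<^sup>2 / 2 + 2 * real n * \<bar>Im z\<bar>)"
    unfolding exp_add[symmetric] cmod_power2 by (simp add: field_simps power2_eq_square)
  finally show ?thesis .
qed

theorem lemma2p2:
  fixes n :: nat and z :: complex and x y :: real
  assumes "n \<ge> 1"
    and "z = of_real x + \<i> * of_real y"
  shows "norm (hermite_fun n z)
           \<le> root 4 (2 * exp 1 ^ 3 / pi\<^sup>2)
               * exp ((norm z)\<^sup>2 / 2 + x\<^sup>2 + \<bar>y\<bar>) * exp (2 * real n * \<bar>y\<bar>)"
proof -
  \<comment> \<open>After division by pi^2 and a fourth root, this compares the constant pi^(-1/4)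
    with the claimed one; e >= 2 and pi < 4 suffice.\<close>
  have "pi \<le> 2 * exp 1 ^ 3"
  proof -
    have "(2::real) ^ 3 \<le> exp 1 ^ 3"
      using exp_ge_add_one_self[of 1] by (intro power_mono) auto
    then show ?thesis
      using pi_less_4 by simp
  qed
  then have "1 / pi \<le> 2 * exp 1 ^ 3 / pi\<^sup>2"
    by (simp add: field_simps power2_eq_square)
  moreover have "pi powr (- 1/4) = root 4 (1 / pi)"
    by (simp add: root_powr_inverse powr_divide powr_minus_divide)
  ultimately have C: "pi powr (- 1/4) \<le> root 4 (2 * exp 1 ^ 3 / pi\<^sup>2)"
    by simp
  have "norm (hermite_fun n z) \<le> pi powr (- 1/4) * exp ((norm z)\<^sup>2 / 2 + 2 * real n * \<bar>y\<bar>)"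
    using cmod_hermite_fun_le[OF assms(1), of z] by (simp add: assms(2))
  also have "\<dots> \<le> root 4 (2 * exp 1 ^ 3 / pi\<^sup>2)
                   * exp (((norm z)\<^sup>2 / 2 + x\<^sup>2 + \<bar>y\<bar>) + 2 * real n * \<bar>y\<bar>)"
    using C by (intro mult_mono) auto
  finally show ?thesis
    by (simp add: exp_add mult.assoc)
qed

end
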